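(* For every integer $n\geq 1$ there is an integer $s_0$ (depending on $n$) such that for all integers $s\geq s_0$ one has $$e_{n,0,s}=g_{n,0,s}.$$
   Context: For integers $n\geq 2r+1$, $r\geq 0$, $s\geq 1$, $m\geq 1$ let $$c_{n,r,m,t}=\sum_{0\leq i<m}\binom{t-i+r}{r}\binom{i+n-r-1}{n-r-1},$$ regarded as a polynomial in $t$ (with $\binom{x+a}{a}=\frac{(x+a)\cdots(x+1)}{a!}$), and let $P_{n,r,s,m}(t)=\binom{t+n}{n}-s\,c_{n,r,m,t}$, a polynomial in $t$ of degree $n$. Substituting $t=m\tau$, the expression $P_{n,r,s,m}(m\tau)$ is a polynomial in $m$ of degree $n$ with coefficients in $\mathbb{Q}[\tau]$; $\Lambda_{n,r,s}(\tau)\in\mathbb{Q}[\tau]$ denotes the coefficient of $m^n$ in it. $g_{n,r,s}$ denotes the largest real root of $\Lambda_{n,r,s}$. Further, $$e_{n,r,s}=\inf\left\{\tfrac{t}{m}:\ t,m\in\mathbb{Z},\ t\geq m\geq 1,\ P_{n,r,s,m}(t)>0\right\}.$$ *)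

theory Defs
  imports Complex_Main "HOL-Computational_Algebra.Polynomial"
begin

text \<open>
  \<open>binom_poly x a\<close> is the binomial \<open>(x + a) \<cdots> (x + 1) / a!\<close> for a polynomial \<open>x\<close>.
\<close>

definition binom_poly :: "rat poly \<Rightarrow> nat \<Rightarrow> rat poly" where
  "binom_poly x a = smult (1 / fact a) (\<Prod>j=1..a. x + of_nat j)"

text \<open>
  The indeterminate of the next two polynomials is \<open>t\<close>. The definitions are meant for
  \<open>n \<ge> 2 * r + 1\<close>, so that the subtractions on naturals are not truncated.
\<close>

definition c_poly :: "nat \<Rightarrow> nat \<Rightarrow> nat \<Rightarrow> rat poly" where
  "c_poly n r m =
     (\<Sum>i<m. smult (of_nat ((i + (n - r - 1)) choose (n - r - 1)))
               (binom_poly ([:0, 1:] - of_nat i) r))"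

definition P_poly :: "nat \<Rightarrow> nat \<Rightarrow> int \<Rightarrow> nat \<Rightarrow> rat poly" where
  "P_poly n r s m = binom_poly [:0, 1:] n - smult (of_int s) (c_poly n r m)"

text \<open>
  The substitution \<open>t = m * \<tau>\<close>, read as a polynomial in \<open>m\<close> over \<open>\<rat>[\<tau>]\<close>: the outer
  indeterminate of \<open>Q\<close> is \<open>m\<close>, the inner one is \<open>\<tau>\<close>. There is at most one such \<open>Q\<close>,
  as its values at infinitely many points \<open>m\<close> are prescribed.
\<close>

definition P_subst :: "nat \<Rightarrow> nat \<Rightarrow> int \<Rightarrow> rat poly poly" where
  "P_subst n r s =
     (THE Q. \<forall>m\<ge>1. poly Q (of_nat m) = pcompose (P_poly n r s m) [:0, of_nat m:])"

definition Lambda :: "nat \<Rightarrow> nat \<Rightarrow> int \<Rightarrow> rat poly" where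
  "Lambda n r s = coeff (P_subst n r s) n"

definition g :: "nat \<Rightarrow> nat \<Rightarrow> int \<Rightarrow> real" where
  "g n r s = (GREATEST x. poly (map_poly of_rat (Lambda n r s)) x = 0)"

definition e :: "nat \<Rightarrow> nat \<Rightarrow> int \<Rightarrow> real" where
  "e n r s = Inf {real t / real m | t m :: nat. t \<ge> m \<and> m \<ge> 1 \<and> poly (P_poly n r s m) (of_nat t) > 0}"

end

theory Submission imports Defs begin

text \<open>
  For \<open>r = 0\<close> the hockey-stick identity sums \<open>c\<close> in closed form, and with rising factorials
  (\<open>pochhammer\<close>) the polynomial becomes
  \<open>n! P(t) = (t+1)\<cdots>(t+n) - s m(m+1)\<cdots>(m+n-1)\<close>. Its part of top degree under \<open>t = m\<tau>\<close> is
  \<open>\<tau>^n - s\<close>, so \<open>g\<close> is \<open>\<sigma> = s^(1/n)\<close>. That \<open>e\<close> is \<open>\<sigma>\<close> as well comes from two bounds.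

  No admissible ratio is below \<open>\<sigma>\<close> once \<open>\<sigma> \<ge> 4\<close>. Assume \<open>t < \<sigma>m\<close> and compare
  \<open>(t+1)\<cdots>(t+n)\<close> with \<open>(\<sigma>m)(\<sigma>(m+1))\<cdots>(\<sigma>(m+n-1))\<close> factor by factor. Every factor except
  the first one is favourable, since \<open>t+j+1 \<le> \<sigma>(m+j)\<close> for \<open>j \<ge> 1\<close>; the possible loss in
  \<open>t+1\<close> against \<open>\<sigma>m\<close> is absorbed by the second factor, which gains about \<open>\<sigma>\<close>. For \<open>n = 1\<close>
  there is no second factor, but then \<open>\<sigma> = s\<close> is an integer and \<open>t < sm\<close> already gives
  \<open>t+1 \<le> sm\<close>.

  Ratios arbitrarily close to \<open>\<sigma>\<close> are admissible: \<open>t \<ge> \<sigma>(m+n)\<close> suffices for \<open>P(t) > 0\<close>, and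
  the least such \<open>t\<close> has \<open>t/m \<le> \<sigma> + (\<sigma>n+1)/m\<close>, where \<open>m\<close> is free.
\<close>

section \<open>The polynomials for r = 0\<close>

text \<open>
  The hockey-stick identity. The rising factorial, unlike \<open>(m + n - 1) choose n\<close>, stays
  meaningful without truncated subtraction and is visibly a polynomial in \<open>m\<close>.
\<close>

lemma fact_mult_sum_binomial_eq_pochhammer:
  assumes "n \<ge> 1"
  shows "fact n * (\<Sum>i<m. of_nat ((i + (n - 1)) choose (n - 1)))
           = pochhammer (of_nat m :: 'a :: field_char_0) n"
proof (cases m)
  case 0
  then show ?thesis using assms by (simp add: pochhammer_0_left)
next
  case (Suc k)
  have "(\<Sum>i<m. (i + (n - 1)) choose (n - 1)) = (\<Sum>i\<le>k. ((n - 1) + i) choose (n - 1))"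
    unfolding Suc lessThan_Suc_atMost by (simp add: add.commute)
  also have "\<dots> = (k + n) choose n"
    using choose_rising_sum(1)[of "n - 1" k] assms by (simp add: add.commute)
  finally have "(\<Sum>i<m. of_nat ((i + (n - 1)) choose (n - 1)))
      = (of_nat ((k + n) choose n) :: 'a)"
    by (metis of_nat_sum)
  also have "\<dots> = pochhammer (of_nat m) n / fact n"
    by (simp add: binomial_gbinomial gbinomial_pochhammer' Suc add.commute)
  finally show ?thesis by simp
qed

lemma c_poly_0:
  assumes "n \<ge> 1"
  shows "c_poly n 0 m = [:pochhammer (of_nat m) n / fact n:]"
proof -
  have "c_poly n 0 m = [:\<Sum>i<m. of_nat ((i + (n - 1)) choose (n - 1)):]"
    unfolding c_poly_def binom_poly_def by (induction m) (simp_all add: one_pCons)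
  then show ?thesis
    using fact_mult_sum_binomial_eq_pochhammer[OF assms, of m, where 'a = rat]
    by (simp add: field_simps)
qed

lemma poly_binom_poly_X: "poly (binom_poly [:0, 1:] n) x = pochhammer (x + 1) n / fact n"
proof -
  have "(\<Prod>j=1..n. x + of_nat j) = pochhammer (x + 1) n" for x :: rat
    by (induction n) (simp_all add: pochhammer_Suc algebra_simps)
  then show ?thesis by (simp add: binom_poly_def poly_prod)
qed

lemma poly_P_poly_0:
  assumes "n \<ge> 1"
  shows "poly (P_poly n 0 s m) x
           = (pochhammer (x + 1) n - of_int s * pochhammer (of_nat m) n) / fact n"
  by (simp add: P_poly_def c_poly_0[OF assms] poly_binom_poly_X diff_divide_distrib)

text \<open>
  Both sides of the inequality are integers, so it holds over the rationals, where \<open>P\<close> is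
  evaluated, exactly when it holds over the reals, where \<open>\<sigma>\<close> exists.
\<close>

lemma pochhammer_less_iff_int:
  "of_int s * pochhammer (of_nat m) n < pochhammer (of_nat t + 1 :: 'a :: linordered_field) n
     \<longleftrightarrow> s * int (pochhammer m n) < int (pochhammer (Suc t) n)"
proof -
  have "of_int s * pochhammer (of_nat m) n = (of_int (s * int (pochhammer m n)) :: 'a)"
    using pochhammer_of_nat[of m n, where 'a = 'a] by simp
  moreover have "pochhammer (of_nat t + 1) n = (of_int (int (pochhammer (Suc t) n)) :: 'a)"
    using pochhammer_of_nat[of "Suc t" n, where 'a = 'a] by (simp add: add.commute)
  ultimately show ?thesis by (metis of_int_less_iff)
qed

lemma P_poly_0_pos_iff:
  assumes "n \<ge> 1"
  shows "poly (P_poly n 0 s m) (of_nat t) > 0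
           \<longleftrightarrow> of_int s * pochhammer (real m) n < pochhammer (real t + 1) n"
  by (simp add: poly_P_poly_0[OF assms] pochhammer_less_iff_int zero_less_divide_iff)

section \<open>The leading coefficient and its largest root\<close>

text \<open>
  The degree bound makes the induction for the coefficient work: it rules out a contribution of
  the constant terms \<open>a j\<close>. The factors are linear in \<open>m\<close>, so \<open>b\<close> is \<open>\<tau>\<close> or \<open>1\<close> below.
\<close>

lemma coeff_prod_linear_card:
  assumes "finite A"
  shows "coeff (\<Prod>j\<in>A. [:a j, b:]) (card A) = b ^ card A"
    and "degree (\<Prod>j\<in>A. [:a j, b:]) \<le> card A"
  using assms
proof (induction A)
  case (insert x A)
  {
    case 1
    have "coeff (\<Prod>j\<in>A. [:a j, b:]) (Suc (card A)) = 0"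
      using insert by (intro coeff_eq_0) simp
    then show ?case using insert by simp
  next
    case 2
    have "degree ([:a x, b:] * (\<Prod>j\<in>A. [:a j, b:])) \<le> 1 + card A"
      using insert by (intro order.trans[OF degree_mult_le] add_mono) simp_all
    then show ?case using insert by simp
  }
qed simp_all

text \<open>
  Rewriting \<open>t + j\<close> as \<open>j + \<tau>m\<close> exhibits a polynomial in \<open>m\<close> with the prescribed values; it is
  the only one because \<open>\<rat>[\<tau>]\<close> is a domain of characteristic zero.
\<close>

lemma P_subst_0:
  assumes "n \<ge> 1"
  shows "P_subst n 0 s = smult [:1 / fact n:]
           ((\<Prod>j=1..n. [:of_nat j, [:0, 1:]:]) - smult (of_int s) (\<Prod>j<n. [:of_nat j, 1:]))"
    (is "_ = ?Q")
  unfolding P_subst_def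
proof (rule the_equality)
  show spec: "\<forall>m\<ge>1. poly ?Q (of_nat m) = pcompose (P_poly n 0 s m) [:0, of_nat m:]"
  proof (intro allI impI)
    fix m :: nat assume "m \<ge> 1"
    have poch: "(\<Prod>j<n. of_nat j + x) = pochhammer x n" "(\<Prod>j=1..n. of_nat j + x) = pochhammer (x + 1) n"
      for x :: rat
      by (induction n) (simp_all add: pochhammer_Suc algebra_simps)
    \<comment> \<open>Two rational polynomials in \<open>\<tau>\<close> are compared through their values.\<close>
    have "poly (poly ?Q (of_nat m)) x = poly (pcompose (P_poly n 0 s m) [:0, of_nat m:]) x" for x
      using poch(1)[of "of_nat m"] poch(2)[of "of_nat m * x"]
      by (simp add: poly_prod poly_pcompose poly_P_poly_0[OF assms] mult.commute)
    then show "poly ?Q (of_nat m) = pcompose (P_poly n 0 s m) [:0, of_nat m:]"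
      using poly_eq_poly_eq_iff by blast
  qed
  fix Q :: "rat poly poly"
  assume Q: "\<forall>m\<ge>1. poly Q (of_nat m) = pcompose (P_poly n 0 s m) [:0, of_nat m:]"
  show "Q = ?Q"
  proof (rule ccontr)
    assume "Q \<noteq> ?Q"
    then have "finite {x. poly (Q - ?Q) x = 0}" by (intro poly_roots_finite) simp
    moreover have "of_nat ` {1..} \<subseteq> {x. poly (Q - ?Q) x = 0}"
      using Q spec by (auto simp del: poly_smult)
    ultimately have "finite (of_nat ` {1..} :: rat poly set)" by (rule finite_subset[rotated])
    then show False
      using finite_imageD[of "of_nat :: nat \<Rightarrow> rat poly" "{1..}"] infinite_Ici
      by (auto simp: inj_on_def)
  qed
qed

lemma Lambda_0:
  assumes "n \<ge> 1"
  shows "Lambda n 0 s = smult (1 / fact n) (monom 1 n - [:of_int s:])"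
proof -
  have "coeff (\<Prod>j=1..n. [:of_nat j, [:0, 1:]:]) n = [:0, 1 :: rat:] ^ n"
    using coeff_prod_linear_card(1)[of "{1..n}" of_nat "[:0, 1 :: rat:]"] by simp
  moreover have "coeff (\<Prod>j<n. [:of_nat j, 1 :: rat poly:]) n = 1"
    using coeff_prod_linear_card(1)[of "{..<n}" of_nat "1 :: rat poly"] by simp
  ultimately show ?thesis
    unfolding Lambda_def P_subst_0[OF assms]
    by (simp add: monom_altdef of_int_poly)
qed

lemma g_0_eq_root:
  assumes "n \<ge> 1" "s \<ge> 0"
  shows "g n 0 s = root n (of_int s)"
proof -
  have fact: "of_rat (fact n) = (fact n :: real)" by (metis of_nat_fact of_rat_of_nat_eq)
  have "map_poly of_rat (Lambda n 0 s) = smult (1 / fact n) (monom 1 n - [:of_int s :: real:])"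
    unfolding Lambda_0[OF assms(1)]
    by (rule poly_eqI)
      (simp add: coeff_map_poly coeff_pCons of_rat_mult of_rat_diff of_rat_divide fact
        del: fact_Suc split: nat.split)
  then have zero_iff: "poly (map_poly of_rat (Lambda n 0 s)) x = 0 \<longleftrightarrow> x ^ n = of_int s"
    for x :: real
    by (simp add: poly_monom)
  show ?thesis
    unfolding g_def zero_iff
  proof (rule Greatest_equality)
    show "root n (of_int s) ^ n = real_of_int s" using assms by simp
    fix x :: real assume x: "x ^ n = of_int s"
    show "x \<le> root n (of_int s)"
    proof (cases "x \<ge> 0")
      case True
      then show ?thesis using assms x real_root_power_cancel[of n x] by simp
    next
      case False
      moreover have "0 \<le> root n (of_int s)" using assms by simp
      ultimately show ?thesis by linarith
    qed
  qed
qed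

section \<open>Comparison of rising factorials\<close>

text \<open>
  For \<open>n = 2\<close> and the extreme value \<open>x = \<sigma>y\<close> this is \<open>3\<sigma>y + 2 \<le> \<sigma>\<^sup>2 y\<close>, which is where \<open>\<sigma> \<ge> 4\<close> comes from; every further
  factor on the left is at most the corresponding factor \<open>\<sigma>(y+j)\<close> on the right.
\<close>

lemma pochhammer_shift_le_scaled:
  fixes x y \<sigma> :: real
  assumes "n \<ge> 2" "\<sigma> \<ge> 4" "y \<ge> 1" "0 \<le> x" "x \<le> \<sigma> * y"
  shows "pochhammer (x + 1) n \<le> \<sigma> ^ n * pochhammer y n"
  using assms(1)
proof (induction n rule: nat_induct_at_least)
  case base
  have "\<sigma> * y \<ge> 4 * 1" using assms by (intro mult_mono) auto
  moreover have "\<sigma> * (\<sigma> * y) \<ge> 4 * (\<sigma> * y)" using assms by (intro mult_right_mono) auto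
  ultimately have "(\<sigma> * y + 1) * (\<sigma> * y + 2) \<le> \<sigma> ^ 2 * (y * (y + 1))"
    by (simp add: algebra_simps power2_eq_square)
  moreover have "(x + 1) * (x + 2) \<le> (\<sigma> * y + 1) * (\<sigma> * y + 2)"
    using assms by (intro mult_mono) auto
  ultimately show ?case by (simp add: numeral_2_eq_2 pochhammer_Suc add.commute)
next
  case (Suc n)
  have "4 * real n \<le> \<sigma> * real n" using assms by (intro mult_right_mono) auto
  then have "x + 1 + real n \<le> \<sigma> * (y + real n)"
    using assms Suc.hyps unfolding distrib_left by linarith
  then have "pochhammer (x + 1) n * (x + 1 + real n)
      \<le> (\<sigma> ^ n * pochhammer y n) * (\<sigma> * (y + real n))"
    using Suc.IH assms by (intro mult_mono) (auto intro!: mult_nonneg_nonneg pochhammer_nonneg)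
  then show ?case by (simp add: pochhammer_Suc mult_ac)
qed

lemma ratio_ge_of_P_poly_0_pos:
  assumes "n \<ge> 1" "\<sigma> \<ge> 4" "\<sigma> ^ n = of_int s" "m \<ge> 1"
    and pos: "poly (P_poly n 0 s m) (of_nat t) > 0"
  shows "\<sigma> \<le> real t / real m"
proof (rule ccontr)
  assume "\<not> \<sigma> \<le> real t / real m"
  then have lt: "real t < \<sigma> * real m" using assms by (simp add: field_simps)
  have "pochhammer (real t + 1) n \<le> of_int s * pochhammer (real m) n"
  proof (cases "n = 1")
    case True
    then have "real t < of_int (s * int m)" using lt assms by simp
    then have "int t < s * int m" by linarith
    then have "of_int (int t + 1) \<le> real_of_int (s * int m)" by (subst of_int_le_iff) simp
    then show ?thesis using True by simp
  next
    case False
    then show ?thesis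
      using pochhammer_shift_le_scaled[of n \<sigma> "real m" "real t"] assms lt by simp
  qed
  then show False using pos P_poly_0_pos_iff[OF assms(1)] by simp
qed

lemma pochhammer_le_power:
  fixes x :: real
  assumes "x \<ge> 0"
  shows "pochhammer x n \<le> (x + real n) ^ n"
  unfolding pochhammer_prod
  using assms prod_mono[of "{0..<n}" "\<lambda>i. x + of_nat i" "\<lambda>_. x + real n"] by simp

lemma power_less_pochhammer_shift:
  fixes x :: real
  assumes "x \<ge> 0" "n \<ge> 1"
  shows "x ^ n < pochhammer (x + 1) n"
  using assms(2)
proof (induction n rule: nat_induct_at_least)
  case (Suc n)
  then have "x ^ n * x < pochhammer (x + 1) n * (x + 1 + real n)"
    using assms(1) by (intro mult_strict_mono') auto
  then show ?case by (simp add: pochhammer_Suc mult.commute)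
qed simp

text \<open>
  Here \<open>(t+1)\<cdots>(t+n)\<close> is replaced by the smaller \<open>t^n\<close> and \<open>m\<cdots>(m+n-1)\<close> by the larger
  \<open>(m+n)^n\<close>. This shifts \<open>m\<close> by a constant only, which is harmless for the limit of \<open>t/m\<close>.
\<close>

lemma P_poly_0_pos:
  assumes "n \<ge> 1" "\<sigma> \<ge> 0" "\<sigma> ^ n = of_int s" "\<sigma> * (real m + real n) \<le> real t"
  shows "poly (P_poly n 0 s m) (of_nat t) > 0"
proof -
  have "of_int s * pochhammer (real m) n \<le> \<sigma> ^ n * (real m + real n) ^ n"
    using assms pochhammer_le_power[of "real m" n]
    by (metis mult_left_mono of_nat_0_le_iff zero_le_power)
  also have "\<dots> = (\<sigma> * (real m + real n)) ^ n" by (simp add: power_mult_distrib)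
  also have "\<dots> \<le> real t ^ n" using assms by (intro power_mono) auto
  also have "\<dots> < pochhammer (real t + 1) n" using assms by (intro power_less_pochhammer_shift) auto
  finally show ?thesis using P_poly_0_pos_iff[OF assms(1)] by simp
qed

section \<open>The infimum\<close>

lemma e_0_eq:
  assumes "n \<ge> 1" "\<sigma> \<ge> 4" "\<sigma> ^ n = of_int s"
  shows "e n 0 s = \<sigma>"
proof -
  define S where "S = {real t / real m | t m :: nat.
    t \<ge> m \<and> m \<ge> 1 \<and> poly (P_poly n 0 s m) (of_nat t) > 0}"
  have lower: "\<sigma> \<le> x" if "x \<in> S" for x
    using that ratio_ge_of_P_poly_0_pos[OF assms] unfolding S_def by blast
  have approx: "\<exists>x\<in>S. x \<le> \<sigma> + \<epsilon>" if "\<epsilon> > 0" for \<epsilon>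
  proof -
    \<comment> \<open>Large enough for \<open>(\<sigma>n + 1)/m < \<epsilon>\<close>, where \<open>+ 1\<close> pays for rounding \<open>t\<close> up.\<close>
    obtain m :: nat where m: "(\<sigma> * real n + 1) / \<epsilon> < real m"
      using reals_Archimedean2 by blast
    moreover have "(\<sigma> * real n + 1) / \<epsilon> > 0" using assms that by (auto intro!: divide_pos_pos add_nonneg_pos)
    ultimately have "m \<ge> 1" by (cases m) auto
    define t where "t = nat \<lceil>\<sigma> * (real m + real n)\<rceil>"
    have nonneg: "0 \<le> \<sigma> * (real m + real n)" using assms by simp
    have t: "\<sigma> * (real m + real n) \<le> real t" "real t \<le> \<sigma> * (real m + real n) + 1"
      unfolding t_def using nonneg by linarith+
    have "1 * real m \<le> \<sigma> * (real m + real n)" using assms by (intro mult_mono) auto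
    then have "t \<ge> m" using t by simp
    then have "real t / real m \<in> S"
      using \<open>m \<ge> 1\<close> P_poly_0_pos[of n \<sigma> s m t] assms t unfolding S_def by auto
    moreover have "real t / real m \<le> \<sigma> + \<epsilon>"
    proof -
      have "\<sigma> * real n + 1 < \<epsilon> * real m" using m that by (simp add: field_simps)
      then have "real t \<le> (\<sigma> + \<epsilon>) * real m" using t by (simp add: algebra_simps)
      then show ?thesis using \<open>m \<ge> 1\<close> by (simp add: field_simps)
    qed
    ultimately show ?thesis by blast
  qed
  have "Inf S = \<sigma>"
  proof (rule cInf_eq_non_empty)
    show "S \<noteq> {}" using approx[of 1] by auto
    show "y \<le> \<sigma>" if "\<And>x. x \<in> S \<Longrightarrow> y \<le> x" for y
      using approx that by (meson field_le_epsilon order.trans)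
  qed (rule lower)
  then show ?thesis by (simp add: e_def S_def)
qed

theorem proposition3p1:
  fixes n :: nat
  assumes "n \<ge> 1"
  shows "\<exists>s0 :: int. \<forall>s :: int. s \<ge> s0 \<longrightarrow> e n 0 s = g n 0 s"
proof (intro exI allI impI)
  fix s :: int
  assume s: "4 ^ n \<le> s"
  then have "(4 :: real) ^ n \<le> of_int s" by (metis of_int_le_iff of_int_numeral of_int_power)
  moreover from this have "0 \<le> real_of_int s" by (rule order.trans[rotated]) simp
  ultimately have "root n (of_int s) \<ge> 4" "root n (of_int s) ^ n = of_int s" "s \<ge> 0"
    using assms real_root_le_mono[of n "4 ^ n" "of_int s"] by (simp_all add: real_root_power_cancel)
  then show "e n 0 s = g n 0 s"
    using e_0_eq[OF assms] g_0_eq_root[OF assms] by simp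
qed

end
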